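(* Let $\rho>2$, $L_0>0$, $L_1\ge0$, $M\ge0$, and let $f:\mathbb{R}^d\to\mathbb{R}\cup\{\infty\}$ be $(\rho,L_0,L_1)$-smooth, with $f(x)\ge f^*$ and $\|\nabla f(x)\|\le M$ for all $x\in\mathcal{X}$, for some $f^*\in\mathbb{R}$. Let $x_0\in\mathcal{X}$, $\Delta:=f(x_0)-f^*$, $\ell(s)=L_0+L_1s^\rho$, and let $\{x_k\}_{k\ge0}$ be generated by $$x_{k+1}=x_k-\gamma_k\nabla f(x_k),\qquad \gamma_k=\int_0^1\frac{dv}{\ell(\|\nabla f(x_k)\|+\|\nabla f(x_k)\|v)}.$$ Then for every $\varepsilon>0$ and every integer $T\ge1$ with $$T\ge\max\left\{\frac{8L_0\Delta}{\varepsilon},\,64L_1\Delta(2M)^{\rho-2}\right\}$$ one has $\min_{k\in\{0,\dots,T-1\}}\|\nabla f(x_k)\|^2\le\varepsilon$.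
   Context: Norms are Euclidean for vectors and spectral for matrices. For $f:\mathbb{R}^d\to\mathbb{R}\cup\{\infty\}$ put $\mathcal{X}=\{x\in\mathbb{R}^d: f(x)<\infty\}$, assumed to be open and convex. $f$ is $(\rho,L_0,L_1)$-smooth if $f$ is twice differentiable on $\mathcal{X}$, continuous on the closure of $\mathcal{X}$ (as a map into $\mathbb{R}\cup\{\infty\}$), and $\|\nabla^2f(x)\|\le L_0+L_1\|\nabla f(x)\|^\rho$ for all $x\in\mathcal{X}$. (The iteration is well defined: the iterates stay in $\mathcal{X}$.) *)

theory Defs
  imports "HOL-Analysis.Analysis"
begin

definition eff_domain :: "(real ^ 'n \<Rightarrow> ereal) \<Rightarrow> (real ^ 'n) set" where
  "eff_domain f = {x. f x < \<infinity>}"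

text \<open>Gradient and Hessian are those of the real-valued function \<open>real_of_ereal \<circ> f\<close>. They are only
  meaningful on the effective domain, which is assumed open wherever they are used, so that the
  derivatives at its points do not depend on the values of \<open>f\<close> outside it.\<close>

definition gradient :: "(real ^ 'n \<Rightarrow> ereal) \<Rightarrow> real ^ 'n \<Rightarrow> real ^ 'n" where
  "gradient f x = (THE g. GDERIV (\<lambda>y. real_of_ereal (f y)) x :> g)"

definition hessian :: "(real ^ 'n \<Rightarrow> ereal) \<Rightarrow> real ^ 'n \<Rightarrow> real ^ 'n ^ 'n" where
  "hessian f x = matrix (frechet_derivative (gradient f) (at x))"

definition twice_differentiable_on_set ::
  "(real ^ 'n \<Rightarrow> ereal) \<Rightarrow> (real ^ 'n) set \<Rightarrow> bool" where
  "twice_differentiable_on_set f S \<longleftrightarrow>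
     (\<forall>x\<in>S. (\<lambda>y. real_of_ereal (f y)) differentiable (at x) \<and> gradient f differentiable (at x))"

text \<open>The library's \<open>norm\<close> on \<open>real ^ 'n ^ 'n\<close> is the Frobenius norm, not the spectral one.\<close>

definition spectral_norm :: "real ^ 'n ^ 'm \<Rightarrow> real" where
  "spectral_norm A = onorm (\<lambda>v. A *v v)"

text \<open>Since \<open>0 powr \<rho> = 0\<close>, this agrees with the usual power for all \<open>s \<ge> 0\<close> when \<open>\<rho> > 0\<close>;
  for \<open>\<rho> = 0\<close> it does not follow the convention \<open>0\<^sup>0 = 1\<close>.\<close>

definition ell :: "real \<Rightarrow> real \<Rightarrow> real \<Rightarrow> real \<Rightarrow> real" where
  "ell \<rho> L0 L1 s = L0 + L1 * s powr \<rho>"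

text \<open>Continuity on the closure refers to the topology of \<open>ereal\<close>: at boundary points of the
  effective domain where \<open>f\<close> is infinite, \<open>f\<close> tends to infinity.\<close>

definition generalized_smooth ::
  "real \<Rightarrow> real \<Rightarrow> real \<Rightarrow> (real ^ 'n \<Rightarrow> ereal) \<Rightarrow> bool" where
  "generalized_smooth \<rho> L0 L1 f \<longleftrightarrow>
     twice_differentiable_on_set f (eff_domain f) \<and>
     continuous_on (closure (eff_domain f)) f \<and>
     (\<forall>x\<in>eff_domain f. spectral_norm (hessian f x) \<le> L0 + L1 * norm (gradient f x) powr \<rho>)"

definition step_size ::
  "real \<Rightarrow> real \<Rightarrow> real \<Rightarrow> (real ^ 'n \<Rightarrow> ereal) \<Rightarrow> real ^ 'n \<Rightarrow> real" where
  "step_size \<rho> L0 L1 f x =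
     integral {0..1} (\<lambda>v. 1 / ell \<rho> L0 L1 (norm (gradient f x) + norm (gradient f x) * v))"

end

theory Submission
  imports Defs
begin

text \<open>
  Write \<open>g = \<parallel>\<nabla>f(x)\<parallel>\<close> and let \<open>x\<^sup>+ = x - \<gamma> \<nabla>f(x)\<close> be one gradient step. Everything rests on the
  decrease \<open>f(x\<^sup>+) \<le> f(x) - g\<^sup>2 / (2 \<ell>(2 g))\<close> together with \<open>x\<^sup>+ \<in> \<X>\<close> (\<open>gradient_step_decrease\<close>).

  Along the segment \<open>y(t) = x - t \<gamma> \<nabla>f(x)\<close>, the deviation \<open>\<phi>(t) = \<nabla>f(y(t)) - \<nabla>f(x)\<close> satisfies
  \<open>\<parallel>\<phi>'\<parallel> \<le> \<gamma> g \<ell>(g + \<parallel>\<phi>\<parallel>)\<close>. The scalar equation \<open>s' = \<ell>(g + s)\<close>, \<open>s(0) = 0\<close>, needs the time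
  \<open>W(s) = \<integral>\<^sub>0\<^sup>s dv / \<ell>(g + v)\<close> to reach height \<open>s\<close>, so comparison gives \<open>W(\<parallel>\<phi>(t)\<parallel>) \<le> t \<gamma> g\<close>
  (\<open>transit_time_norm_le\<close>). The step size is chosen exactly so that \<open>\<gamma> g = W(g)\<close>. Since \<open>W\<close> is
  increasing and concave with \<open>W(0) = 0\<close>, the inequality \<open>W(\<parallel>\<phi>(t)\<parallel>) \<le> t W(g)\<close> forces
  \<open>\<parallel>\<phi>(t)\<parallel> \<le> t g\<close> (\<open>le_scaled_if_transit_time_le\<close>). Hence the derivative of \<open>f(y(t))\<close> is at most
  \<open>- \<gamma> g\<^sup>2 (1 - t)\<close>, and integrating gives a decrease of \<open>\<gamma> g\<^sup>2 / 2\<close>, where \<open>\<gamma> \<ge> 1 / \<ell>(2 g)\<close>.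

  All this holds as long as the segment remains in \<open>\<X>\<close>. It cannot leave: as long as it is inside,
  \<open>f\<close> stays below \<open>f(x)\<close>, and continuity on the closure keeps \<open>f\<close> finite at a first exit point.

  Finally, if \<open>g\<^sup>2 > \<epsilon>\<close> at each of the first \<open>T\<close> iterates, then every decrease is larger than \<open>\<Delta> / T\<close>:
  the \<open>L0\<close> part of \<open>\<ell>(2 g)\<close> is absorbed by \<open>T \<ge> 8 L0 \<Delta> / \<epsilon>\<close> and the \<open>L1\<close> part, by \<open>g \<le> M\<close>, by
  the other lower bound on \<open>T\<close> (\<open>decrease_lower_bound\<close>). The total then exceeds \<open>\<Delta>\<close>, although
  \<open>f\<close> cannot fall below \<open>fstar\<close>.
\<close>

section \<open>Transit times of scalar autonomous equations\<close>

text \<open>The time that the solution of \<open>s' = l(s)\<close> starting at \<open>0\<close> needs to reach height \<open>s\<close>.\<close>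

definition transit_time :: "(real \<Rightarrow> real) \<Rightarrow> real \<Rightarrow> real" where
  "transit_time l s = integral {0..s} (\<lambda>v. 1 / l v)"

definition growth_function :: "(real \<Rightarrow> real) \<Rightarrow> bool" where
  "growth_function l \<longleftrightarrow> continuous_on {0..} l \<and> mono_on {0..} l \<and> l 0 > 0"

lemma growth_function_pos:
  assumes "growth_function l" "s \<ge> 0"
  shows "l s > 0"
proof -
  have "l 0 \<le> l s"
    using assms by (auto simp: growth_function_def intro: mono_onD[of "{0..}" l])
  then show ?thesis
    using assms by (auto simp: growth_function_def)
qed

lemma growth_function_le:
  assumes "growth_function l" "0 \<le> s" "s \<le> t"
  shows "l s \<le> l t"
  using assms by (auto simp: growth_function_def intro: mono_onD[of "{0..}" l])

lemma growth_function_shift: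
  assumes "growth_function l" "g \<ge> 0"
  shows "growth_function (\<lambda>v. l (g + v))"
proof -
  have "continuous_on {0..} (\<lambda>v. l (g + v))"
  proof (rule continuous_on_compose2[where g = l])
    show "continuous_on {0..} l"
      using assms by (simp add: growth_function_def)
    show "continuous_on {0..} (\<lambda>v. g + v)"
      by (intro continuous_intros)
  qed (use assms in auto)
  moreover have "mono_on {0..} (\<lambda>v. l (g + v))"
    using assms(2) by (intro mono_onI growth_function_le[OF assms(1)]) auto
  ultimately show ?thesis
    using growth_function_pos[OF assms] by (simp add: growth_function_def)
qed

lemma continuous_on_inverse_growth:
  assumes "growth_function l"
  shows "continuous_on {0..s} (\<lambda>v. 1 / l v)"
proof (intro continuous_intros)
  show "continuous_on {0..s} l"
    using assms by (auto simp: growth_function_def intro: continuous_on_subset)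
  show "\<forall>v\<in>{0..s}. l v \<noteq> 0"
    using growth_function_pos[OF assms] by fastforce
qed

lemma transit_time_0: "transit_time l 0 = 0"
  by (simp add: transit_time_def)

lemma transit_time_has_derivative:
  assumes l: "growth_function l" and s: "s > 0"
  shows "(transit_time l has_real_derivative 1 / l s) (at s)"
proof -
  have "(transit_time l has_vector_derivative 1 / l s) (at s within {0..s + 1})"
    unfolding transit_time_def
    by (rule integral_has_vector_derivative)
      (use continuous_on_inverse_growth[OF l] s in auto)
  moreover have "at s within {0..s + 1} = at s"
    using s by (intro at_within_interior) auto
  ultimately show ?thesis
    by (simp add: has_real_derivative_iff_has_vector_derivative)
qed

lemma transit_time_continuous:
  assumes "growth_function l"
  shows "continuous_on {0..s} (transit_time l)"
  unfolding transit_time_def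
  by (intro indefinite_integral_continuous_1 integrable_continuous_interval
      continuous_on_inverse_growth assms)

lemma transit_time_strict_mono:
  assumes l: "growth_function l" and st: "0 \<le> s" "s < t"
  shows "transit_time l s < transit_time l t"
proof (rule DERIV_pos_imp_increasing_open[OF st(2)])
  fix v assume "s < v" "v < t"
  then show "\<exists>y. (transit_time l has_real_derivative y) (at v) \<and> 0 < y"
    using transit_time_has_derivative[OF l, of v] growth_function_pos[OF l, of v] st
    by (intro exI[of _ "1 / l v"]) auto
next
  show "continuous_on {s..t} (transit_time l)"
    using transit_time_continuous[OF l, of t] by (rule continuous_on_subset) (use st in auto)
qed

lemma transit_time_mono:
  assumes "growth_function l" "0 \<le> s" "s \<le> t"
  shows "transit_time l s \<le> transit_time l t"
  using transit_time_strict_mono[OF assms(1,2), of t] assms(3) by (cases "s = t") auto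

lemma transit_time_le_linear:
  assumes l: "growth_function l" and s: "0 \<le> s"
  shows "transit_time l s \<le> s / l 0"
proof -
  have "transit_time l s \<le> integral {0..s} (\<lambda>v. 1 / l 0)"
    unfolding transit_time_def
  proof (rule integral_le)
    fix v assume "v \<in> {0..s}"
    then show "1 / l v \<le> 1 / l 0"
      using growth_function_pos[OF l, of 0] growth_function_le[OF l, of 0 v]
      by (auto intro!: divide_left_mono mult_pos_pos growth_function_pos[OF l])
  qed (intro integrable_continuous_interval continuous_on_inverse_growth l integrable_const_ivl)+
  then show ?thesis
    using s by simp
qed

lemma inverse_growth_scaled_integrable:
  assumes "growth_function l" "s \<ge> 0"
  shows "(\<lambda>v. 1 / l (s * v)) integrable_on {0..1}"
proof (intro integrable_continuous_interval
    continuous_on_compose2[OF continuous_on_inverse_growth[OF assms(1), of s]])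
  show "continuous_on {0..1} (\<lambda>v. s * v)"
    by (intro continuous_intros)
qed (use assms(2) in \<open>auto intro: mult_left_le\<close>)

text \<open>Substituting \<open>s v\<close> for the integration variable turns the transit time into the form in which
  the step size is defined.\<close>

lemma transit_time_scaled:
  assumes l: "growth_function l" and s: "s \<ge> 0"
  shows "transit_time l s = s * integral {0..1} (\<lambda>v. 1 / l (s * v))"
proof (cases "s = 0")
  case False
  with s have s: "s > 0"
    by simp
  have "((\<lambda>v. s * (1 / l (s * v))) has_integral transit_time l (s * 1) - transit_time l (s * 0)) {0..1}"
  proof (rule fundamental_theorem_of_calculus_interior)
    show "continuous_on {0..1} (\<lambda>v. transit_time l (s * v))"
    proof (rule continuous_on_compose2[OF transit_time_continuous[OF l, of s]])
      show "continuous_on {0..1} (\<lambda>v. s * v)"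
        by (intro continuous_intros)
    qed (use s in \<open>auto intro: mult_left_le\<close>)
    fix v :: real assume v: "v \<in> {0<..<1}"
    have "((\<lambda>v. transit_time l (s * v)) has_real_derivative 1 / l (s * v) * s) (at v)"
      by (rule DERIV_chain2[OF transit_time_has_derivative[OF l] DERIV_cmult_Id])
        (use s v in simp)
    then show "((\<lambda>v. transit_time l (s * v)) has_vector_derivative s * (1 / l (s * v))) (at v)"
      by (simp add: has_real_derivative_iff_has_vector_derivative mult.commute)
  qed simp
  then have "integral {0..1} (\<lambda>v. s * (1 / l (s * v))) = transit_time l s"
    by (simp only: integral_unique transit_time_0 mult_1_right mult_zero_right diff_zero)
  then show ?thesis
    by (simp only: integral_mult_right)
qed (simp add: transit_time_0)

text \<open>Because \<open>1 / l\<close> is decreasing, \<open>transit_time l\<close> is concave. With \<open>\<gamma>\<close> the slope of its chord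
  over \<open>[0, g]\<close>, the graph lies above that chord, so heights grow at most linearly up to \<open>g\<close>.
  Monotonicity rules out \<open>h > g\<close>, where the chord gives no information.\<close>

lemma le_scaled_if_transit_time_le:
  assumes l: "growth_function l" and hg: "h \<ge> 0" "g \<ge> 0" and t: "0 \<le> t" "t \<le> 1"
    and le: "transit_time l h \<le> t * transit_time l g"
  shows "h \<le> t * g"
proof -
  have Wg: "0 \<le> transit_time l g"
    using transit_time_mono[OF l, of 0 g] hg by (simp add: transit_time_0)
  have "t * transit_time l g \<le> transit_time l g"
    using t Wg by (simp add: mult_left_le_one_le)
  with le have "transit_time l h \<le> transit_time l g"
    by simp
  then have hg': "h \<le> g"
    using transit_time_strict_mono[OF l hg(2), of h] by linarith
  define \<gamma> where "\<gamma> = integral {0..1} (\<lambda>v. 1 / l (g * v))"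
  have "integral {0..1} (\<lambda>v::real. 1 / l g) \<le> \<gamma>"
    unfolding \<gamma>_def
    by (rule integral_le)
      (use hg in \<open>auto intro!: inverse_growth_scaled_integrable[OF l] divide_left_mono mult_pos_pos
        growth_function_pos[OF l] growth_function_le[OF l] mult_left_le\<close>)
  then have \<gamma>: "\<gamma> > 0"
    using growth_function_pos[OF l hg(2)] by (simp add: order_less_le_trans[of 0 "1 / l g"])
  have "\<gamma> \<le> integral {0..1} (\<lambda>v. 1 / l (h * v))"
    unfolding \<gamma>_def
    by (rule integral_le)
      (use hg hg' in \<open>auto intro!: inverse_growth_scaled_integrable[OF l] divide_left_mono mult_pos_pos
        growth_function_pos[OF l] growth_function_le[OF l] mult_right_mono\<close>)
  then have "\<gamma> * h \<le> transit_time l h"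
    using hg by (simp add: transit_time_scaled[OF l] mult.commute[of \<gamma>] mult_left_mono)
  also have "\<dots> \<le> \<gamma> * (t * g)"
    using le by (simp add: transit_time_scaled[OF l hg(2)] \<gamma>_def mult_ac)
  finally show ?thesis
    using \<gamma> by simp
qed

section \<open>Comparison for vector-valued curves\<close>

text \<open>In terms of \<open>transit_time l\<close> the differential inequality says that \<open>transit_time l \<parallel>\<phi>\<parallel>\<close> has
  slope at most \<open>c\<close>. Since the norm is not differentiable at zeros of \<open>\<phi>\<close>, the argument is run
  with \<open>sqrt (\<parallel>\<phi>\<parallel>\<^sup>2 + \<delta>\<^sup>2)\<close>, which costs only the initial value \<open>transit_time l \<delta> \<le> \<delta> / l 0\<close>.\<close>

lemma transit_time_norm_le:
  fixes \<phi> :: "real \<Rightarrow> 'a::real_inner"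
  assumes l: "growth_function l" and c: "c \<ge> 0" and b: "b \<ge> 0" and init: "\<phi> 0 = 0"
    and deriv: "\<And>t. 0 \<le> t \<Longrightarrow> t \<le> b \<Longrightarrow> (\<phi> has_vector_derivative \<phi>' t) (at t)"
    and bound: "\<And>t. 0 \<le> t \<Longrightarrow> t \<le> b \<Longrightarrow> norm (\<phi>' t) \<le> c * l (norm (\<phi> t))"
  shows "transit_time l (norm (\<phi> b)) \<le> c * b"
proof (rule field_le_epsilon)
  fix e :: real assume e: "e > 0"
  define \<delta> where "\<delta> = e * l 0"
  have l0: "l 0 > 0"
    using growth_function_pos[OF l, of 0] by simp
  then have \<delta>: "\<delta> > 0"
    using e by (simp add: \<delta>_def)
  define n where "n = (\<lambda>t. sqrt (\<phi> t \<bullet> \<phi> t + \<delta>\<^sup>2))"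
  have pos: "\<phi> t \<bullet> \<phi> t + \<delta>\<^sup>2 > 0" for t
    using \<delta> by (simp add: add_nonneg_pos)
  then have n_pos: "n t > 0" for t
    by (simp add: n_def)
  have n_ge: "norm (\<phi> t) \<le> n t" for t
    by (auto simp: n_def norm_eq_sqrt_inner)
  have "transit_time l (n b) - c * b \<le> transit_time l (n 0) - c * 0"
  proof (rule DERIV_nonpos_imp_nonincreasing[OF b])
    fix t assume t: "0 \<le> t" "t \<le> b"
    have "((\<lambda>t. \<phi> t \<bullet> \<phi> t + \<delta>\<^sup>2) has_real_derivative 2 * (\<phi> t \<bullet> \<phi>' t)) (at t)"
      using deriv[OF t] unfolding has_vector_derivative_def has_field_derivative_def
      by (auto intro!: derivative_eq_intros simp: inner_commute algebra_simps)
    from DERIV_chain2[where f = sqrt, OF DERIV_real_sqrt[OF pos[of t]] this]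
    have dn: "(n has_real_derivative (\<phi> t \<bullet> \<phi>' t) / n t) (at t)"
      by (simp add: n_def[abs_def] field_simps)
    have d: "((\<lambda>t. transit_time l (n t) - c * t) has_real_derivative
        1 / l (n t) * ((\<phi> t \<bullet> \<phi>' t) / n t) - c) (at t)"
      by (auto intro!: derivative_eq_intros
          DERIV_chain2[OF transit_time_has_derivative[OF l n_pos] dn])
    have "\<phi> t \<bullet> \<phi>' t \<le> norm (\<phi> t) * norm (\<phi>' t)"
      by (rule norm_cauchy_schwarz)
    also have "\<dots> \<le> n t * (c * l (n t))"
    proof (rule mult_mono)
      have "norm (\<phi>' t) \<le> c * l (norm (\<phi> t))"
        by (rule bound[OF t])
      also have "\<dots> \<le> c * l (n t)"
        using c n_ge[of t] by (intro mult_left_mono growth_function_le[OF l]) auto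
      finally show "norm (\<phi>' t) \<le> c * l (n t)" .
    qed (use n_ge n_pos[of t] in auto)
    finally have "(\<phi> t \<bullet> \<phi>' t) / n t \<le> c * l (n t)"
      using n_pos[of t] by (simp add: field_simps)
    then have "1 / l (n t) * ((\<phi> t \<bullet> \<phi>' t) / n t) \<le> c"
      using growth_function_pos[OF l, of "n t"] n_pos[of t] by (simp add: pos_divide_le_eq)
    with d show "\<exists>y. ((\<lambda>t. transit_time l (n t) - c * t) has_real_derivative y) (at t) \<and> y \<le> 0"
      by (intro exI[of _ "1 / l (n t) * ((\<phi> t \<bullet> \<phi>' t) / n t) - c"]) simp
  qed
  moreover have "transit_time l (norm (\<phi> b)) \<le> transit_time l (n b)"
    by (rule transit_time_mono[OF l _ n_ge]) simp
  moreover have "n 0 = \<delta>"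
    using \<delta> by (simp add: n_def init)
  moreover have "transit_time l \<delta> \<le> e"
    using transit_time_le_linear[OF l, of \<delta>] \<delta> l0 by (simp add: \<delta>_def)
  ultimately show "transit_time l (norm (\<phi> b)) \<le> c * b + e"
    by simp
qed

section \<open>Gradient and Hessian\<close>

lemma GDERIV_gradient:
  assumes "(\<lambda>y. real_of_ereal (f y)) differentiable (at x)"
  shows "GDERIV (\<lambda>y. real_of_ereal (f y)) x :> gradient f x"
proof -
  obtain D where D: "((\<lambda>y. real_of_ereal (f y)) has_derivative D) (at x)"
    using assms by (auto simp: differentiable_def)
  then have "linear D"
    by (rule has_derivative_linear)
  then have "D = (\<lambda>h. h \<bullet> adjoint D 1)"
    using adjoint_works[of D _ 1] by (auto simp: fun_eq_iff inner_commute)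
  with D have G: "GDERIV (\<lambda>y. real_of_ereal (f y)) x :> adjoint D 1"
    by (simp add: gderiv_def)
  have "gradient f x = adjoint D 1"
    unfolding gradient_def
  proof (rule the_equality)
    show "GDERIV (\<lambda>y. real_of_ereal (f y)) x :> adjoint D 1"
      by (rule G)
  next
    fix g assume "GDERIV (\<lambda>y. real_of_ereal (f y)) x :> g"
    with G have "(\<lambda>h. h \<bullet> g) = (\<lambda>h. h \<bullet> adjoint D 1)"
      unfolding gderiv_def by (rule has_derivative_unique[rotated])
    then show "g = adjoint D 1"
      by (simp add: fun_eq_iff vector_eq_ldot)
  qed
  with G show ?thesis
    by simp
qed

lemma gradient_derivative_bound:
  assumes "gradient f differentiable (at x)"
  obtains D where "(gradient f has_derivative D) (at x)"
    "\<And>v. norm (D v) \<le> spectral_norm (hessian f x) * norm v"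
proof
  let ?D = "frechet_derivative (gradient f) (at x)"
  show D: "(gradient f has_derivative ?D) (at x)"
    using assms by (simp add: frechet_derivative_works)
  then have lin: "linear ?D"
    by (rule has_derivative_linear)
  fix v
  have "(\<lambda>v. hessian f x *v v) = ?D"
    using lin by (simp add: hessian_def fun_eq_iff matrix_works)
  then have "spectral_norm (hessian f x) = onorm ?D"
    by (simp add: spectral_norm_def)
  then show "norm (?D v) \<le> spectral_norm (hessian f x) * norm v"
    using onorm[of ?D v] D by (simp add: has_derivative_bounded_linear)
qed

lemma growth_function_ell:
  assumes "\<rho> > 0" "L0 > 0" "L1 \<ge> 0"
  shows "growth_function (ell \<rho> L0 L1)"
proof -
  have "continuous_on {0..} (\<lambda>s. L0 + L1 * s powr \<rho>)"
    by (intro continuous_on_add continuous_on_mult continuous_on_const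
        continuous_on_powr' continuous_on_id) (use assms(1) in auto)
  moreover have "mono_on {0..} (\<lambda>s. L0 + L1 * s powr \<rho>)"
  proof (rule mono_onI)
    fix s t :: real assume "s \<in> {0..}" "s \<le> t"
    then have "s powr \<rho> \<le> t powr \<rho>"
      using assms(1) by (intro powr_mono2) auto
    then show "L0 + L1 * s powr \<rho> \<le> L0 + L1 * t powr \<rho>"
      using assms(3) by (simp add: mult_left_mono)
  qed
  ultimately show ?thesis
    using assms(2) unfolding growth_function_def ell_def by simp
qed

section \<open>One gradient step\<close>

locale smooth_step =
  fixes f :: "real ^ 'n \<Rightarrow> ereal" and \<rho> L0 L1 :: real and x :: "real ^ 'n"
  assumes \<rho>: "\<rho> > 0" and L0: "L0 > 0" and L1: "L1 \<ge> 0"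
    and not_minf: "\<And>y. f y \<noteq> -\<infinity>"
    and open_dom: "open (eff_domain f)" and convex_dom: "convex (eff_domain f)"
    and smooth: "generalized_smooth \<rho> L0 L1 f"
    and x: "x \<in> eff_domain f"
begin

abbreviation "l \<equiv> ell \<rho> L0 L1"
abbreviation "g \<equiv> norm (gradient f x)"
abbreviation "\<gamma> \<equiv> step_size \<rho> L0 L1 f x"

definition segment_point :: "real \<Rightarrow> real ^ 'n" where
  "segment_point t = x - (t * \<gamma>) *\<^sub>R gradient f x"

lemma growth_l: "growth_function l"
  by (rule growth_function_ell[OF \<rho> L0 L1])

lemma growth_shifted: "growth_function (\<lambda>v. l (g + v))"
  by (rule growth_function_shift[OF growth_l]) simp

text \<open>The identity that explains the step size: a unit-speed comparison solution reaches height \<open>g\<close>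
  precisely when the step, of length \<open>\<gamma> g\<close>, has been completed.\<close>

lemma step_size_times_gradient: "transit_time (\<lambda>v. l (g + v)) g = \<gamma> * g"
  using transit_time_scaled[OF growth_shifted, of g] by (simp add: step_size_def mult.commute)

lemma step_size_ge: "1 / l (2 * g) \<le> \<gamma>"
proof -
  have "integral {0..1} (\<lambda>v::real. 1 / l (2 * g)) \<le> \<gamma>"
    unfolding step_size_def
    by (rule integral_le)
      (use inverse_growth_scaled_integrable[OF growth_shifted, of g] in
        \<open>auto intro!: divide_left_mono mult_pos_pos growth_function_pos[OF growth_l]
          growth_function_le[OF growth_l] mult_left_le\<close>)
  then show ?thesis
    by simp
qed

lemma step_size_pos: "\<gamma> > 0"
  using step_size_ge growth_function_pos[OF growth_l, of "2 * g"]
  by (simp add: order_less_le_trans[of 0 "1 / l (2 * g)"])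

lemma segment_point_has_derivative:
  "(segment_point has_derivative (\<lambda>h. h *\<^sub>R (- \<gamma> *\<^sub>R gradient f x))) (at t)"
  unfolding segment_point_def by (auto intro!: derivative_eq_intros)

lemma segment_in_domain:
  assumes "segment_point b \<in> eff_domain f" "0 \<le> t" "t \<le> b"
  shows "segment_point t \<in> eff_domain f"
proof (cases "b = 0")
  case False
  with assms have b: "b > 0"
    by simp
  have "segment_point t = (1 - t / b) *\<^sub>R x + (t / b) *\<^sub>R segment_point b"
    using b by (simp add: segment_point_def algebra_simps)
  moreover have "\<dots> \<in> eff_domain f"
    by (rule convexD[OF convex_dom x assms(1)]) (use assms b in auto)
  ultimately show ?thesis
    by simp
qed (use assms in auto)

text \<open>The gradient at a point of the segment has norm at most \<open>g + \<parallel>\<phi>\<parallel>\<close>, so the Hessian bound becomes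
  a differential inequality for \<open>\<phi>\<close> alone, and the comparison lemma applies.\<close>

lemma gradient_change_on_segment:
  assumes b: "0 \<le> b" "b \<le> 1" and dom: "segment_point b \<in> eff_domain f"
  shows "norm (gradient f (segment_point b) - gradient f x) \<le> b * g"
proof -
  define \<phi> where "\<phi> = (\<lambda>t. gradient f (segment_point t) - gradient f x)"
  define D where "D = (\<lambda>y. SOME D. (gradient f has_derivative D) (at y) \<and>
      (\<forall>v. norm (D v) \<le> spectral_norm (hessian f y) * norm v))"
  have D: "(gradient f has_derivative D y) (at y)"
      "norm (D y v) \<le> spectral_norm (hessian f y) * norm v"
    if "y \<in> eff_domain f" for y v
  proof -
    have "gradient f differentiable (at y)"
      using smooth that by (auto simp: generalized_smooth_def twice_differentiable_on_set_def)
    then have "\<exists>D. (gradient f has_derivative D) (at y) \<and>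
        (\<forall>v. norm (D v) \<le> spectral_norm (hessian f y) * norm v)"
      using gradient_derivative_bound by metis
    from someI_ex[OF this] show "(gradient f has_derivative D y) (at y)"
      "norm (D y v) \<le> spectral_norm (hessian f y) * norm v"
      by (auto simp: D_def)
  qed
  have "transit_time (\<lambda>v. l (g + v)) (norm (\<phi> b)) \<le> \<gamma> * g * b"
  proof (rule transit_time_norm_le[OF growth_shifted,
        where \<phi>' = "\<lambda>t. D (segment_point t) (- \<gamma> *\<^sub>R gradient f x)"])
    fix t assume t: "0 \<le> t" "t \<le> b"
    have y: "segment_point t \<in> eff_domain f"
      by (rule segment_in_domain[OF dom t])
    have lin: "linear (D (segment_point t))"
      using D(1)[OF y] by (rule has_derivative_linear)
    have "(\<phi> has_derivative (\<lambda>h. D (segment_point t) (h *\<^sub>R (- \<gamma> *\<^sub>R gradient f x)))) (at t)"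
      unfolding \<phi>_def
      using has_derivative_compose[OF segment_point_has_derivative D(1)[OF y]]
      by (auto intro!: derivative_eq_intros)
    then show "(\<phi> has_vector_derivative D (segment_point t) (- \<gamma> *\<^sub>R gradient f x)) (at t)"
      unfolding has_vector_derivative_def
      by (simp only: linear_cmul[OF lin])
    have "norm (gradient f (segment_point t)) \<le> g + norm (\<phi> t)"
      unfolding \<phi>_def by norm
    then have "l (norm (gradient f (segment_point t))) \<le> l (g + norm (\<phi> t))"
      by (intro growth_function_le[OF growth_l]) auto
    moreover have "spectral_norm (hessian f (segment_point t)) \<le> l (norm (gradient f (segment_point t)))"
      using smooth y by (auto simp: generalized_smooth_def ell_def)
    ultimately have "spectral_norm (hessian f (segment_point t)) * (\<gamma> * g) \<le> l (g + norm (\<phi> t)) * (\<gamma> * g)"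
      using step_size_pos by (intro mult_right_mono) auto
    with D(2)[OF y, of "- \<gamma> *\<^sub>R gradient f x"]
    show "norm (D (segment_point t) (- \<gamma> *\<^sub>R gradient f x)) \<le> \<gamma> * g * l (g + norm (\<phi> t))"
      using step_size_pos by (simp add: mult_ac)
  qed (use b step_size_pos in \<open>auto simp: \<phi>_def segment_point_def\<close>)
  then have "transit_time (\<lambda>v. l (g + v)) (norm (\<phi> b)) \<le> b * transit_time (\<lambda>v. l (g + v)) g"
    by (simp add: step_size_times_gradient mult_ac)
  then show ?thesis
    using le_scaled_if_transit_time_le[OF growth_shifted, of "norm (\<phi> b)" g b] b
    by (simp add: \<phi>_def)
qed

text \<open>By the preceding bound \<open>\<nabla>f(x) \<bullet> \<nabla>f(y(t)) \<ge> (1 - t) g\<^sup>2\<close>; the quadratic \<open>b - b\<^sup>2 / 2\<close> is the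
  integral of \<open>1 - t\<close>.\<close>

lemma descent_on_segment:
  assumes b: "0 \<le> b" "b \<le> 1" and dom: "segment_point b \<in> eff_domain f"
  shows "real_of_ereal (f (segment_point b)) \<le> real_of_ereal (f x) - \<gamma> * g\<^sup>2 * (b - b\<^sup>2 / 2)"
proof -
  define F where "F = (\<lambda>y. real_of_ereal (f y))"
  have "F (segment_point b) + \<gamma> * g\<^sup>2 * (b - b\<^sup>2 / 2)
      \<le> F (segment_point 0) + \<gamma> * g\<^sup>2 * (0 - 0\<^sup>2 / 2)"
  proof (rule DERIV_nonpos_imp_nonincreasing[OF b(1)])
    fix t assume t: "0 \<le> t" "t \<le> b"
    have y: "segment_point t \<in> eff_domain f"
      by (rule segment_in_domain[OF dom t])
    let ?G = "gradient f (segment_point t)"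
    have "GDERIV F (segment_point t) :> ?G"
      unfolding F_def using smooth y
      by (intro GDERIV_gradient) (auto simp: generalized_smooth_def twice_differentiable_on_set_def)
    then have "((\<lambda>t. F (segment_point t)) has_derivative
        (\<lambda>h. (h *\<^sub>R (- \<gamma> *\<^sub>R gradient f x)) \<bullet> ?G)) (at t)"
      unfolding gderiv_def by (rule has_derivative_compose[OF segment_point_has_derivative])
    then have "((\<lambda>t. F (segment_point t)) has_real_derivative - \<gamma> * (gradient f x \<bullet> ?G)) (at t)"
      by (rule has_derivative_imp_has_field_derivative) (simp add: mult_ac)
    then have d: "((\<lambda>t. F (segment_point t) + \<gamma> * g\<^sup>2 * (t - t\<^sup>2 / 2)) has_real_derivative
        - \<gamma> * (gradient f x \<bullet> ?G) + \<gamma> * g\<^sup>2 * (1 - t)) (at t)"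
      by (auto intro!: derivative_eq_intros)
    have "gradient f x \<bullet> (gradient f x - ?G) \<le> g * norm (gradient f x - ?G)"
      by (rule norm_cauchy_schwarz)
    also have "\<dots> \<le> g * (t * g)"
      using gradient_change_on_segment[of t] t b y
      by (intro mult_left_mono) (auto simp: norm_minus_commute)
    finally have "g\<^sup>2 * (1 - t) \<le> gradient f x \<bullet> ?G"
      by (simp add: inner_diff_right power2_norm_eq_inner algebra_simps power2_eq_square[of g])
        (simp add: power2_norm_eq_inner[symmetric] power2_eq_square algebra_simps)
    then have "\<gamma> * (g\<^sup>2 * (1 - t)) \<le> \<gamma> * (gradient f x \<bullet> ?G)"
      using step_size_pos by (intro mult_left_mono) auto
    with d show "\<exists>z. ((\<lambda>t. F (segment_point t) + \<gamma> * g\<^sup>2 * (t - t\<^sup>2 / 2)) has_real_derivative z) (at t)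
        \<and> z \<le> 0"
      by (intro exI[of _ "- \<gamma> * (gradient f x \<bullet> ?G) + \<gamma> * g\<^sup>2 * (1 - t)"]) (simp add: mult.assoc)
  qed
  then show ?thesis
    by (simp add: F_def segment_point_def)
qed

lemma f_eq_ereal: "y \<in> eff_domain f \<Longrightarrow> f y = ereal (real_of_ereal (f y))"
  using not_minf[of y] by (cases "f y") (auto simp: eff_domain_def)

text \<open>The parameters in \<open>[0, 1]\<close> whose points lie in the domain form a relatively open set, since the
  domain is open. By the descent estimate the same set is cut out by membership in the sublevel set
  \<open>K\<close>, which is closed because \<open>f\<close> is continuous on the closure of its domain. Connectedness of
  \<open>[0, 1]\<close> concludes.\<close>

lemma segment_stays_in_domain: "segment_point 1 \<in> eff_domain f"
proof -
  have cont_y: "continuous_on {0..1} segment_point"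
    unfolding segment_point_def by (intro continuous_intros)
  define K where "K = closure (eff_domain f) \<inter> f -` {..f x}"
  define A where "A = {0..1} \<inter> segment_point -` eff_domain f"
  have "closed K"
    unfolding K_def using smooth
    by (intro continuous_closed_preimage) (auto simp: generalized_smooth_def)
  have le: "f (segment_point t) \<le> f x" if t: "0 \<le> t" "t \<le> 1" "segment_point t \<in> eff_domain f" for t
  proof -
    have "t\<^sup>2 \<le> t"
      using t by (simp add: power2_eq_square mult_left_le_one_le)
    then have "0 \<le> \<gamma> * g\<^sup>2 * (t - t\<^sup>2 / 2)"
      using step_size_pos t by (intro mult_nonneg_nonneg) auto
    then have "real_of_ereal (f (segment_point t)) \<le> real_of_ereal (f x)"
      using descent_on_segment[OF t] by linarith
    then show ?thesis
      using f_eq_ereal[OF x] f_eq_ereal[OF t(3)] by (metis ereal_less_eq(3))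
  qed
  have "K \<subseteq> eff_domain f"
    using x by (auto simp: K_def eff_domain_def)
  then have "A = {0..1} \<inter> segment_point -` K"
    using le closure_subset[of "eff_domain f"] by (auto simp: A_def K_def)
  then have clo: "closedin (top_of_set {0..1}) A"
    using continuous_closedin_preimage[OF cont_y \<open>closed K\<close>] by simp
  have op: "openin (top_of_set {0..1}) A"
    unfolding A_def by (rule continuous_openin_preimage_gen[OF cont_y open_dom])
  have "connected {0..1::real}"
    by (rule connected_Icc)
  then have "A = {} \<or> A = {0..1}"
    unfolding connected_clopen using clo op by meson
  moreover have "0 \<in> A"
    using x by (simp add: A_def segment_point_def)
  ultimately have "1 \<in> A"
    by force
  then show ?thesis
    by (auto simp: A_def)
qed

lemma gradient_step_decrease:
  "x - \<gamma> *\<^sub>R gradient f x \<in> eff_domain f"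
  "real_of_ereal (f (x - \<gamma> *\<^sub>R gradient f x)) \<le> real_of_ereal (f x) - g\<^sup>2 / (2 * l (2 * g))"
proof -
  have eq: "segment_point 1 = x - \<gamma> *\<^sub>R gradient f x"
    by (simp add: segment_point_def)
  show "x - \<gamma> *\<^sub>R gradient f x \<in> eff_domain f"
    using segment_stays_in_domain by (simp add: eq)
  have "g\<^sup>2 / 2 * (1 / l (2 * g)) \<le> g\<^sup>2 / 2 * \<gamma>"
    by (rule mult_left_mono[OF step_size_ge]) simp
  with descent_on_segment[OF _ _ segment_stays_in_domain]
  show "real_of_ereal (f (x - \<gamma> *\<^sub>R gradient f x)) \<le> real_of_ereal (f x) - g\<^sup>2 / (2 * l (2 * g))"
    by (simp add: eq mult_ac)
qed

end

section \<open>Counting iterations\<close>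

text \<open>From \<open>(2 g)\<^sup>\<rho> \<le> 4 g\<^sup>2 (2 M)\<^bsup>\<rho> - 2\<^esup>\<close> one gets
  \<open>2 \<Delta> \<ell>(2 g) \<le> 2 L0 \<Delta> + 8 L1 \<Delta> (2 M)\<^bsup>\<rho> - 2\<^esup> g\<^sup>2\<close>, and the two lower bounds on \<open>T\<close> make these terms
  at most \<open>T g\<^sup>2 / 4\<close> and \<open>T g\<^sup>2 / 8\<close>. Strictness comes from the positivity of \<open>T g\<^sup>2\<close> and so
  covers \<open>\<Delta> = 0\<close>.\<close>

lemma decrease_lower_bound:
  fixes g :: real
  assumes par: "\<rho> > 2" "L0 > 0" "L1 \<ge> 0" and g: "0 < g" "g \<le> M" "g\<^sup>2 > \<epsilon>" and \<epsilon>: "\<epsilon> > 0"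
    and \<Delta>: "\<Delta> \<ge> 0" and T: "T > 0" "T \<ge> 8 * L0 * \<Delta> / \<epsilon>"
      "T \<ge> 64 * L1 * \<Delta> * (2 * M) powr (\<rho> - 2)"
  shows "\<Delta> < T * (g\<^sup>2 / (2 * ell \<rho> L0 L1 (2 * g)))"
proof -
  have "(2 * g) powr \<rho> = (2 * g) powr 2 * (2 * g) powr (\<rho> - 2)"
    by (simp flip: powr_add)
  also have "\<dots> = 4 * g\<^sup>2 * (2 * g) powr (\<rho> - 2)"
    using g by (simp add: powr_numeral power_mult_distrib)
  also have "\<dots> \<le> 4 * g\<^sup>2 * (2 * M) powr (\<rho> - 2)"
    using par g by (intro mult_left_mono powr_mono2) auto
  finally have "L1 * (2 * g) powr \<rho> \<le> L1 * (4 * g\<^sup>2 * (2 * M) powr (\<rho> - 2))"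
    using par by (intro mult_left_mono)
  then have ell_le: "ell \<rho> L0 L1 (2 * g) \<le> L0 + 4 * L1 * (2 * M) powr (\<rho> - 2) * g\<^sup>2"
    by (simp add: ell_def mult_ac)
  have ell_pos: "ell \<rho> L0 L1 (2 * g) > 0"
    using growth_function_pos[OF growth_function_ell, of \<rho> L0 L1 "2 * g"] par g by simp
  have "8 * L0 * \<Delta> \<le> T * \<epsilon>"
    using T \<epsilon> by (simp add: pos_divide_le_eq)
  also have "\<dots> < T * g\<^sup>2"
    using T g by simp
  finally have 1: "8 * L0 * \<Delta> < T * g\<^sup>2" .
  have 2: "64 * L1 * \<Delta> * (2 * M) powr (\<rho> - 2) * g\<^sup>2 \<le> T * g\<^sup>2"
    using T by (intro mult_right_mono) auto
  have "\<Delta> * (2 * ell \<rho> L0 L1 (2 * g)) \<le> \<Delta> * (2 * (L0 + 4 * L1 * (2 * M) powr (\<rho> - 2) * g\<^sup>2))"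
    using ell_le \<Delta> by (intro mult_left_mono) auto
  also have "\<dots> = 8 * L0 * \<Delta> / 4 + 64 * L1 * \<Delta> * (2 * M) powr (\<rho> - 2) * g\<^sup>2 / 8"
    by (simp add: algebra_simps)
  also have "\<dots> < T * g\<^sup>2"
    using 1 2 mult_pos_pos[OF T(1) zero_less_power[OF g(1), of 2]] by linarith
  finally show ?thesis
    using ell_pos by (simp add: pos_less_divide_eq)
qed

theorem mainTheorem6:
  fixes f :: "real ^ 'n \<Rightarrow> ereal"
    and x :: "nat \<Rightarrow> real ^ 'n"
    and x0 :: "real ^ 'n"
    and \<rho> L0 L1 M fstar \<Delta> \<epsilon> :: real
    and T :: nat
  assumes "\<rho> > 2" and "L0 > 0" and "L1 \<ge> 0" and "M \<ge> 0"
    and "\<And>y. f y \<noteq> -\<infinity>"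
    and "open (eff_domain f)" and "convex (eff_domain f)"
    and "generalized_smooth \<rho> L0 L1 f"
    and "\<And>y. y \<in> eff_domain f \<Longrightarrow> f y \<ge> ereal fstar"
    and "\<And>y. y \<in> eff_domain f \<Longrightarrow> norm (gradient f y) \<le> M"
    and "x0 \<in> eff_domain f"
    and "\<Delta> = real_of_ereal (f x0) - fstar"
    and "x 0 = x0"
    and "\<And>k. x (Suc k) = x k - step_size \<rho> L0 L1 f (x k) *\<^sub>R gradient f (x k)"
    and "\<epsilon> > 0"
    and "T \<ge> 1"
    and "real T \<ge> max (8 * L0 * \<Delta> / \<epsilon>) (64 * L1 * \<Delta> * (2 * M) powr (\<rho> - 2))"
  shows "Min ((\<lambda>k. (norm (gradient f (x k)))\<^sup>2) ` {0..T - 1}) \<le> \<epsilon>"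
proof (rule ccontr)
  assume "\<not> ?thesis"
  then have large: "\<epsilon> < (norm (gradient f (x k)))\<^sup>2" if "k < T" for k
    using that assms(16) by (force simp: not_le)
  define d where "d k = (norm (gradient f (x k)))\<^sup>2 / (2 * ell \<rho> L0 L1 (2 * norm (gradient f (x k))))" for k
  have iterates: "x k \<in> eff_domain f \<and> real_of_ereal (f (x k)) \<le> real_of_ereal (f x0) - (\<Sum>i<k. d i)" for k
  proof (induction k)
    case 0
    then show ?case
      using assms by simp
  next
    case (Suc k)
    interpret smooth_step f \<rho> L0 L1 "x k"
      by unfold_locales (use assms Suc in auto)
    show ?case
      using gradient_step_decrease Suc by (simp add: assms(14) d_def)
  qed
  have fstar_le: "fstar \<le> real_of_ereal (f y)" if "y \<in> eff_domain f" for y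
    using assms(9)[OF that] assms(5)[of y] that by (cases "f y") (auto simp: eff_domain_def)
  have \<Delta>: "\<Delta> \<ge> 0"
    using fstar_le assms(11,12) by simp
  have "(\<Sum>i<T. \<Delta> / real T) < (\<Sum>i<T. d i)"
  proof (rule sum_strict_mono)
    fix i assume "i \<in> {..<T}"
    then have gi: "(norm (gradient f (x i)))\<^sup>2 > \<epsilon>"
      using large by simp
    then have "norm (gradient f (x i)) > 0"
      using assms(15) by auto
    then have "\<Delta> < real T * d i"
      unfolding d_def using iterates gi assms \<Delta>
      by (intro decrease_lower_bound[where M = M and \<epsilon> = \<epsilon>]) auto
    then show "\<Delta> / real T < d i"
      using assms(16) by (simp add: pos_divide_less_eq mult.commute)
  qed (use assms(16) in \<open>auto simp: lessThan_empty_iff\<close>)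
  then have "\<Delta> < (\<Sum>i<T. d i)"
    using assms(16) by simp
  moreover have "(\<Sum>i<T. d i) \<le> \<Delta>"
    using iterates[of T] fstar_le[of "x T"] assms(12) by simp
  ultimately show False
    by simp
qed

end
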